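(* Let $f,g,\mathfrak S,F,\eta$ be as in the DC composite-type problem described in the context, and suppose that $F$ satisfies the descent assumption (with constants $\varpi_1,\varpi_2>0$ and $\kappa_\mu=\varpi_1+\varpi_2\mu^{-1}$). Let $(\mu_k)_{k=1}^\infty\subset(0,(2\eta)^{-1}]$ satisfy (i) $\lim_{k\to\infty}\mu_k=0$, (ii) $\sum_{k=1}^\infty\mu_k=\infty$, (iii) $\mu_k\ge\mu_{k+1}$ for all $k\in\mathbb N$. Let $(\gamma_{\mathrm{init},k})_{k=1}^\infty\subset(0,\infty)$ satisfy: there exists $\delta>0$ such that $\gamma_{\mathrm{init},k}\ge\delta\,\kappa_{\mu_k}^{-1}$ for all $k\in\mathbb N$. Let $\boldsymbol x_1\in\mathbb R^d$, $\rho\in(0,1)$, $c\in(0,1)$ be arbitrary. Let $F_k:=F^{\langle\mu_k\rangle}$ and let $(\boldsymbol x_k)_{k=1}^\infty$ be the sequence generated by the variable smoothing algorithm (described in the context) with these inputs. Then: (a) There is a constant $C>0$ such that for all $\underline k,\bar k\in\mathbb N$ with $\underline k\le\bar k$, $$\min_{\underline k\le k\le\bar k}\|\nabla F_k(\boldsymbol x_k)\|\le\sqrt{\frac{C}{\sum_{k=\underline k}^{\bar k}\mu_k}}.$$ (b) $\liminf_{k\to\infty}\|\nabla F_k(\boldsymbol x_k)\|=0$. (c) One can choose a subsequence $(\boldsymbol x_{m(l)})_{l=1}^\infty$, with $m:\mathbb N\to\mathbb N$ monotonically increasing, such that $\lim_{l\to\infty}\|\nabla F_{m(l)}(\boldsymbol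 x_{m(l)})\|=0$. Moreover, every cluster point of $(\boldsymbol x_{m(l)})_{l=1}^\infty$ is a DC composite critical point of the problem of minimizing $F$.
   Context: $\|\cdot\|$ and $\langle\cdot,\cdot\rangle$ are the Euclidean norm and inner product. DC composite-type problem: minimize $F(\boldsymbol x):=(f-g)\circ\mathfrak S(\boldsymbol x)$ over $\boldsymbol x\in\mathbb R^d$, where - $f,g:\mathbb R^n\to\mathbb R$ are respectively $\eta_f$- and $\eta_g$-weakly convex with $\eta_f,\eta_g>0$ (i.e. $f+\frac{\eta_f}{2}\|\cdot\|^2$ and $g+\frac{\eta_g}{2}\|\cdot\|^2$ are convex), and $L_f$- and $L_g$-Lipschitz continuous with $L_f,L_g>0$; put $\eta:=\max\{\eta_f,\eta_g\}$. (Their proximity operators are also assumed to be available as computational tools; this has no further mathematical content.) - $\mathfrak S:\mathbb R^d\to\mathbb R^n$ is differentiable and its Fréchet derivative $\mathrm D\mathfrak S:\mathbb R^d\to\mathbb R^{n\times d}$ is $L_{\mathrm D\mathfrak S}$-Lipschitz continuous (operator norm on matrices). - $\inf_{\boldsymbol x\in\mathbb R^d}F(\boldsymbol x)>-\infty$. Moreau envelope: for an $\eta_\psi$-weakly convex $\psi:\mathbb R^n\to\mathbb R$ and $\mu\in(0,\eta_\psi^{-1})$, ${}^{\mu}\psi(\bar{\boldsymbol z}):=\min_{\boldsymbol z\in\mathbb R^n}\{\psi(\boldsymbol z)+\frac1{2\mu}\|\boldsymbol z-\bar{\boldsymbol z}\|^2\}$; it is continuously differentiable. Smooth surrogate: $F^{\langle\mu\rangle}:=({}^{\mu}f-{}^{\mu}g)\circ\mathfrak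 S$ for $\mu\in(0,\eta^{-1})$. Descent assumption: there exist $\varpi_1,\varpi_2>0$ such that for all $\boldsymbol x,\boldsymbol y\in\mathbb R^d$ and all $\mu\in(0,(2\eta)^{-1}]$, $$F^{\langle\mu\rangle}(\boldsymbol y)\le F^{\langle\mu\rangle}(\boldsymbol x)+\langle\nabla F^{\langle\mu\rangle}(\boldsymbol x),\boldsymbol y-\boldsymbol x\rangle+\frac{\kappa_\mu}{2}\|\boldsymbol y-\boldsymbol x\|^2,\qquad \kappa_\mu:=\varpi_1+\varpi_2\mu^{-1}.$$ Variable smoothing algorithm: given $\boldsymbol x_1\in\mathbb R^d$ and $(\mu_k)$, for $k=1,2,3,\dots$ set $F_k:=F^{\langle\mu_k\rangle}$, obtain a stepsize $\gamma_k$ by backtracking, and set $\boldsymbol x_{k+1}:=\boldsymbol x_k-\gamma_k\nabla F_k(\boldsymbol x_k)$. Backtracking (inputs $\gamma_{\mathrm{init},k}>0$, $\rho,c\in(0,1)$): start with $\tilde\gamma:=\gamma_{\mathrm{init},k}$; while the Armijo condition $$F_k(\boldsymbol x_k-\gamma\nabla F_k(\boldsymbol x_k))\le F_k(\boldsymbol x_k)-c\gamma\|\nabla F_k(\boldsymbol x_k)\|^2$$ with $\gamma=\tilde\gamma$ is false, replace $\tilde\gamma$ by $\rho\tilde\gamma$; output $\gamma_k:=\tilde\gamma$. (Under the descent assumption this loop terminates after finitely many steps.) Subdifferentials: for $\psi:\mathbb R^N\to\mathbb R$, the Fréchet subdifferential $\partial_{\mathrm F}\psi(\hat{\boldsymbol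 x})$ is the set of all $\boldsymbol w\in\mathbb R^N$ with $\lim_{\delta\searrow0}\inf_{0<\|\boldsymbol x-\hat{\boldsymbol x}\|<\delta}\frac{\psi(\boldsymbol x)-\psi(\hat{\boldsymbol x})-\langle\boldsymbol w,\boldsymbol x-\hat{\boldsymbol x}\rangle}{\|\boldsymbol x-\hat{\boldsymbol x}\|}\ge0$. The limiting subdifferential $\partial_{\mathrm L}\psi(\bar{\boldsymbol x})$ is the set of all $\boldsymbol v$ for which there exist $\boldsymbol x_k\to\bar{\boldsymbol x}$ with $\psi(\boldsymbol x_k)\to\psi(\bar{\boldsymbol x})$ and $\boldsymbol v_k\in\partial_{\mathrm F}\psi(\boldsymbol x_k)$ with $\boldsymbol v_k\to\boldsymbol v$. DC composite critical point: $\boldsymbol x^\star\in\mathbb R^d$ with $\boldsymbol 0\in\partial_{\mathrm L}(f\circ\mathfrak S)(\boldsymbol x^\star)-\partial_{\mathrm L}(g\circ\mathfrak S)(\boldsymbol x^\star)$, where $S_1-S_2:=\{\boldsymbol v_1-\boldsymbol v_2\mid \boldsymbol v_1\in S_1,\boldsymbol v_2\in S_2\}$. *)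

theory Defs
  imports "HOL-Analysis.Analysis" "HOL-Library.While_Combinator"
begin

definition weakly_convex :: "real \<Rightarrow> ('a::euclidean_space \<Rightarrow> real) \<Rightarrow> bool" where
  "weakly_convex \<eta> \<psi> \<longleftrightarrow> convex_on UNIV (\<lambda>z. \<psi> z + \<eta> / 2 * (norm z)\<^sup>2)"

text \<open>For \<open>\<psi>\<close> \<open>\<eta>\<close>-weakly convex and \<open>0 < \<mu> < 1 / \<eta>\<close> the function under the infimum is continuous,
  strongly convex and coercive, so the infimum is a minimum.\<close>
definition moreau_env :: "real \<Rightarrow> ('a::euclidean_space \<Rightarrow> real) \<Rightarrow> 'a \<Rightarrow> real" where
  "moreau_env \<mu> \<psi> zbar = (INF z. \<psi> z + 1 / (2 * \<mu>) * (norm (z - zbar))\<^sup>2)"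

text \<open>The gradient vector; meaningful only at points of differentiability.\<close>
definition grad :: "('a::euclidean_space \<Rightarrow> real) \<Rightarrow> 'a \<Rightarrow> 'a" where
  "grad h x = (THE D. GDERIV h x :> D)"

definition dc_objective ::
  "('b::euclidean_space \<Rightarrow> real) \<Rightarrow> ('b \<Rightarrow> real) \<Rightarrow> ('a::euclidean_space \<Rightarrow> 'b) \<Rightarrow> 'a \<Rightarrow> real" where
  "dc_objective f g S x = f (S x) - g (S x)"

definition surrogate ::
  "('b::euclidean_space \<Rightarrow> real) \<Rightarrow> ('b \<Rightarrow> real) \<Rightarrow> ('a::euclidean_space \<Rightarrow> 'b) \<Rightarrow> real \<Rightarrow> 'a \<Rightarrow> real" where
  "surrogate f g S \<mu> x = moreau_env \<mu> f (S x) - moreau_env \<mu> g (S x)"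

definition kappa :: "real \<Rightarrow> real \<Rightarrow> real \<Rightarrow> real" where
  "kappa \<omega>1 \<omega>2 \<mu> = \<omega>1 + \<omega>2 * inverse \<mu>"

definition descent_assumption ::
  "('b::euclidean_space \<Rightarrow> real) \<Rightarrow> ('b \<Rightarrow> real) \<Rightarrow> ('a::euclidean_space \<Rightarrow> 'b) \<Rightarrow> real \<Rightarrow> real \<Rightarrow> real \<Rightarrow> bool"
  where
  "descent_assumption f g S \<eta> \<omega>1 \<omega>2 \<longleftrightarrow>
     (\<forall>x y. \<forall>\<mu>\<in>{0<..inverse (2 * \<eta>)}.
        surrogate f g S \<mu> y \<le> surrogate f g S \<mu> x + grad (surrogate f g S \<mu>) x \<bullet> (y - x)
                              + kappa \<omega>1 \<omega>2 \<mu> / 2 * (norm (y - x))\<^sup>2)"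

definition armijo :: "('a::euclidean_space \<Rightarrow> real) \<Rightarrow> 'a \<Rightarrow> real \<Rightarrow> real \<Rightarrow> bool" where
  "armijo h x c \<gamma> \<longleftrightarrow> h (x - \<gamma> *\<^sub>R grad h x) \<le> h x - c * \<gamma> * (norm (grad h x))\<^sup>2"

definition backtracking :: "('a::euclidean_space \<Rightarrow> real) \<Rightarrow> 'a \<Rightarrow> real \<Rightarrow> real \<Rightarrow> real \<Rightarrow> real" where
  "backtracking h x \<gamma>init \<rho> c = while (\<lambda>\<gamma>. \<not> armijo h x c \<gamma>) (\<lambda>\<gamma>. \<rho> * \<gamma>) \<gamma>init"

text \<open>All sequences are indexed by \<open>k \<ge> 1\<close>; their values at index \<open>0\<close> play no role.\<close>
definition variable_smoothing ::
  "('b::euclidean_space \<Rightarrow> real) \<Rightarrow> ('b \<Rightarrow> real) \<Rightarrow> ('a::euclidean_space \<Rightarrow> 'b) \<Rightarrow> (nat \<Rightarrow> real) \<Rightarrow>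
   (nat \<Rightarrow> real) \<Rightarrow> real \<Rightarrow> real \<Rightarrow> 'a \<Rightarrow> (nat \<Rightarrow> 'a) \<Rightarrow> bool" where
  "variable_smoothing f g S \<mu> \<gamma>init \<rho> c x1 x \<longleftrightarrow>
     x 1 = x1 \<and>
     (\<forall>k\<ge>1. x (Suc k) =
        x k - backtracking (surrogate f g S (\<mu> k)) (x k) (\<gamma>init k) \<rho> c
                *\<^sub>R grad (surrogate f g S (\<mu> k)) (x k))"

text \<open>\<open>Liminf (at xhat)\<close> is the limit, as \<open>\<delta>\<close> decreases to \<open>0\<close>, of the infima over
  \<open>0 < norm (x - xhat) < \<delta>\<close>. These infima may be \<open>-\<infinity>\<close>, hence the extended reals.\<close>
definition frechet_subdifferential :: "('a::euclidean_space \<Rightarrow> real) \<Rightarrow> 'a \<Rightarrow> 'a set" where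
  "frechet_subdifferential \<psi> xhat =
     {w. Liminf (at xhat) (\<lambda>x. ereal ((\<psi> x - \<psi> xhat - w \<bullet> (x - xhat)) / norm (x - xhat))) \<ge> 0}"

definition limiting_subdifferential :: "('a::euclidean_space \<Rightarrow> real) \<Rightarrow> 'a \<Rightarrow> 'a set" where
  "limiting_subdifferential \<psi> xbar =
     {v. \<exists>(x :: nat \<Rightarrow> 'a) (w :: nat \<Rightarrow> 'a).
           x \<longlonglongrightarrow> xbar \<and> (\<lambda>k. \<psi> (x k)) \<longlonglongrightarrow> \<psi> xbar \<and>
           (\<forall>k. w k \<in> frechet_subdifferential \<psi> (x k)) \<and> w \<longlonglongrightarrow> v}"

definition dc_composite_critical ::
  "('b::euclidean_space \<Rightarrow> real) \<Rightarrow> ('b \<Rightarrow> real) \<Rightarrow> ('a::euclidean_space \<Rightarrow> 'b) \<Rightarrow> 'a \<Rightarrow> bool" where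
  "dc_composite_critical f g S xstar \<longleftrightarrow>
     0 \<in> {v1 - v2 | v1 v2. v1 \<in> limiting_subdifferential (f \<circ> S) xstar \<and>
                           v2 \<in> limiting_subdifferential (g \<circ> S) xstar}"

definition cluster_point :: "(nat \<Rightarrow> 'a::topological_space) \<Rightarrow> 'a \<Rightarrow> bool" where
  "cluster_point s p \<longleftrightarrow> (\<exists>r :: nat \<Rightarrow> nat. strict_mono r \<and> (s \<circ> r) \<longlonglongrightarrow> p)"

end

(* For an L-Lipschitz psi the envelope of parameter mu is (L^2/2)-Lipschitz and decreasing in mu, so
   E_k = F_k(x_k) + mu_k Lf^2/2 decreases by at least c gamma_k |grad F_k(x_k)|^2 per step, while E_k
   stays above inf F. Backtracking keeps gamma_k >= const * mu_k, so sum mu_k |grad F_k(x_k)|^2 is finite.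

   If u is a proximal point of z, weak convexity shows that a = (z - u)/mu satisfies
   psi w >= psi u + <a, w - u> - eta/2 |w - u|^2 for all w, and a is the gradient of the envelope at z.
   Such inequalities survive limits and composition with S, so no calculus of limiting
   subdifferentials is needed: bounded gradients a_k, b_k of the two envelopes accumulate at a, b with
   DS(p)^*(a - b) = 0, and DS(p)^* a = DS(p)^* b lies in both Frechet subdifferentials at p. *)

theory Submission
  imports Defs
begin

section \<open>Moreau envelopes and proximal points of Lipschitz functions\<close>

text \<open>A relation instead of a chosen minimiser: later arguments take an arbitrary
  \<open>u\<close> that attains the infimum in \<open>moreau_env\<close>.\<close>

definition prox_point :: "real \<Rightarrow> ('a::euclidean_space \<Rightarrow> real) \<Rightarrow> 'a \<Rightarrow> 'a \<Rightarrow> bool" where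
  "prox_point \<mu> \<psi> z u \<longleftrightarrow>
     (\<forall>w. \<psi> u + 1 / (2 * \<mu>) * (norm (u - z))\<^sup>2 \<le> \<psi> w + 1 / (2 * \<mu>) * (norm (w - z))\<^sup>2)"

lemma lipschitz_diff_le:
  fixes \<psi> :: "'a::real_normed_vector \<Rightarrow> real"
  assumes "L-lipschitz_on UNIV \<psi>"
  shows "\<psi> u \<le> \<psi> w + L * norm (u - w)"
  using lipschitz_onD[OF assms, of u w] by (auto simp: dist_norm)

text \<open>With r = \<open>norm (w - z)\<close>, the Lipschitz bound loses at most L r, and r^2 /
  (2 \<mu>) - L r + \<mu> L^2 / 2 is the square (r - \<mu> L)^2 / (2 \<mu>).\<close>

lemma moreau_objective_ge:
  fixes \<psi> :: "'a::euclidean_space \<Rightarrow> real"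
  assumes "L-lipschitz_on UNIV \<psi>" "\<mu> > 0"
  shows "\<psi> z - \<mu> * L\<^sup>2 / 2 \<le> \<psi> w + 1 / (2 * \<mu>) * (norm (w - z))\<^sup>2"
proof -
  have "0 \<le> (norm (w - z) - \<mu> * L)\<^sup>2 / (2 * \<mu>)"
    using assms by simp
  also have "\<dots> = 1 / (2 * \<mu>) * (norm (w - z))\<^sup>2 - L * norm (w - z) + \<mu> * L\<^sup>2 / 2"
    using assms(2) by (simp add: field_simps power2_eq_square)
  finally show ?thesis
    using lipschitz_diff_le[OF assms(1), of z w] by (simp add: norm_minus_commute)
qed

lemma bdd_below_moreau_objective:
  fixes \<psi> :: "'a::euclidean_space \<Rightarrow> real"
  assumes "L-lipschitz_on UNIV \<psi>" "\<mu> > 0"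
  shows "bdd_below (range (\<lambda>w. \<psi> w + 1 / (2 * \<mu>) * (norm (w - z))\<^sup>2))"
  by (rule bdd_belowI2[where m = "\<psi> z - \<mu> * L\<^sup>2 / 2"]) (rule moreau_objective_ge[OF assms])

lemma moreau_env_le:
  fixes \<psi> :: "'a::euclidean_space \<Rightarrow> real"
  assumes "L-lipschitz_on UNIV \<psi>" "\<mu> > 0"
  shows "moreau_env \<mu> \<psi> z \<le> \<psi> w + 1 / (2 * \<mu>) * (norm (w - z))\<^sup>2"
  unfolding moreau_env_def
  by (rule cINF_lower[OF bdd_below_moreau_objective[OF assms]]) simp

lemma moreau_env_le_self:
  fixes \<psi> :: "'a::euclidean_space \<Rightarrow> real"
  assumes "L-lipschitz_on UNIV \<psi>" "\<mu> > 0"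
  shows "moreau_env \<mu> \<psi> z \<le> \<psi> z"
  using moreau_env_le[OF assms, of z z] by simp

lemma moreau_env_ge:
  fixes \<psi> :: "'a::euclidean_space \<Rightarrow> real"
  assumes "L-lipschitz_on UNIV \<psi>" "\<mu> > 0"
  shows "\<psi> z - \<mu> * L\<^sup>2 / 2 \<le> moreau_env \<mu> \<psi> z"
  unfolding moreau_env_def by (intro cINF_greatest moreau_objective_ge[OF assms]) simp

lemma moreau_env_antimono:
  fixes \<psi> :: "'a::euclidean_space \<Rightarrow> real"
  assumes "L-lipschitz_on UNIV \<psi>" "0 < \<nu>" "\<nu> \<le> \<mu>"
  shows "moreau_env \<mu> \<psi> z \<le> moreau_env \<nu> \<psi> z"
  unfolding moreau_env_def[of \<nu>]
proof (rule cINF_greatest)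
  fix w
  have "1 / (2 * \<mu>) * (norm (w - z))\<^sup>2 \<le> 1 / (2 * \<nu>) * (norm (w - z))\<^sup>2"
    using assms by (intro mult_right_mono divide_left_mono) auto
  then show "moreau_env \<mu> \<psi> z \<le> \<psi> w + 1 / (2 * \<nu>) * (norm (w - z))\<^sup>2"
    using moreau_env_le[OF assms(1), of \<mu> z w] assms by linarith
qed simp

text \<open>Heuristically the derivative of the envelope in \<mu> is -1/2 times the squared norm of
  its gradient in z, and that gradient is bounded by L. The constant L^2 / 2 is the one in the
  correction term of the energy.\<close>

lemma moreau_env_lipschitz_parameter:
  fixes \<psi> :: "'a::euclidean_space \<Rightarrow> real"
  assumes L: "L-lipschitz_on UNIV \<psi>" and \<nu>: "0 < \<nu>" "\<nu> \<le> \<mu>"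
  shows "moreau_env \<nu> \<psi> z \<le> moreau_env \<mu> \<psi> z + (\<mu> - \<nu>) * L\<^sup>2 / 2"
proof -
  have "moreau_env \<nu> \<psi> z - (\<mu> - \<nu>) * L\<^sup>2 / 2 \<le> \<psi> w + 1 / (2 * \<mu>) * (norm (w - z))\<^sup>2" for w
  proof -
    \<comment> \<open>Compare \<open>w\<close> with the point that divides the segment from \<open>z\<close> to \<open>w\<close> in the ratio \<open>\<nu> / \<mu>\<close>.\<close>
    define q where "q = z + (\<nu> / \<mu>) *\<^sub>R (w - z)"
    define t where "t = norm (w - z) / \<mu>"
    have \<mu>: "\<mu> > 0" using \<nu> by simp
    have nw: "norm (w - z) = \<mu> * t"
      using \<mu> by (simp add: t_def)
    have nq: "norm (q - z) = \<nu> * t"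
      using \<mu> \<nu> by (simp add: q_def t_def)
    have "q - w = (1 - \<nu> / \<mu>) *\<^sub>R (z - w)"
      by (simp add: q_def algebra_simps)
    then have nqw: "norm (q - w) = (\<mu> - \<nu>) * t"
      using \<mu> \<nu> nw by (simp add: norm_minus_commute left_diff_distrib)
    have "moreau_env \<nu> \<psi> z \<le> \<psi> q + 1 / (2 * \<nu>) * (\<nu> * t)\<^sup>2"
      using moreau_env_le[OF L \<nu>(1), of z q] nq by simp
    also have "\<dots> \<le> \<psi> w + L * ((\<mu> - \<nu>) * t) + \<nu> * t\<^sup>2 / 2"
      using lipschitz_diff_le[OF L, of q w] nqw \<nu> by (simp add: power2_eq_square mult_ac)
    \<comment> \<open>The excess over the objective at \<open>w\<close> is (\<mu> - \<nu>) (L t -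
      t^2 / 2); completing the square in t bounds it independently of \<open>w\<close>.\<close>
    also have "\<dots> = \<psi> w + 1 / (2 * \<mu>) * (\<mu> * t)\<^sup>2 + (\<mu> - \<nu>) * (L\<^sup>2 - (L - t)\<^sup>2) / 2"
      using \<mu> by (simp add: field_simps power2_eq_square)
    also have "\<dots> \<le> \<psi> w + 1 / (2 * \<mu>) * (\<mu> * t)\<^sup>2 + (\<mu> - \<nu>) * L\<^sup>2 / 2"
      using \<nu> by (intro add_left_mono divide_right_mono mult_left_mono) auto
    finally show ?thesis
      by (simp add: nw)
  qed
  then have "moreau_env \<nu> \<psi> z - (\<mu> - \<nu>) * L\<^sup>2 / 2 \<le> moreau_env \<mu> \<psi> z"
    unfolding moreau_env_def[of \<mu>] by (intro cINF_greatest) auto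
  then show ?thesis by simp
qed

lemma moreau_env_prox_point:
  fixes \<psi> :: "'a::euclidean_space \<Rightarrow> real"
  assumes "prox_point \<mu> \<psi> z u"
  shows "moreau_env \<mu> \<psi> z = \<psi> u + 1 / (2 * \<mu>) * (norm (u - z))\<^sup>2"
  unfolding moreau_env_def
  using assms by (intro cInf_eq_minimum) (auto simp: prox_point_def)

text \<open>Outside the ball of radius 2 \<mu> L the quadratic term is at least the Lipschitz loss,
  so the objective is no smaller than at \<open>z\<close>; a minimiser over the compact ball is
  therefore global. The radius later bounds (z - u) / \<mu> by 2 L, uniformly in \<mu>.\<close>

lemma prox_point_exists:
  fixes \<psi> :: "'a::euclidean_space \<Rightarrow> real"
  assumes L: "L-lipschitz_on UNIV \<psi>" and \<mu>: "\<mu> > 0"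
  shows "\<exists>u. prox_point \<mu> \<psi> z u \<and> norm (u - z) \<le> 2 * \<mu> * L"
proof -
  let ?h = "\<lambda>w. \<psi> w + 1 / (2 * \<mu>) * (norm (w - z))\<^sup>2"
  have L0: "L \<ge> 0" using L by (rule lipschitz_on_nonneg)
  have "continuous_on (cball z (2 * \<mu> * L)) ?h"
    by (intro continuous_intros continuous_on_subset[OF lipschitz_on_continuous_on[OF L]]) auto
  moreover have "z \<in> cball z (2 * \<mu> * L)" using L0 \<mu> by simp
  ultimately obtain u where u: "u \<in> cball z (2 * \<mu> * L)"
    and umin: "\<And>w. w \<in> cball z (2 * \<mu> * L) \<Longrightarrow> ?h u \<le> ?h w"
    using continuous_attains_inf[OF compact_cball, of z "2 * \<mu> * L" ?h] by blast
  have "?h u \<le> ?h w" for w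
  proof (cases "w \<in> cball z (2 * \<mu> * L)")
    case False
    then have "2 * \<mu> * L \<le> norm (w - z)"
      by (simp add: dist_norm norm_minus_commute)
    then have "L * norm (w - z) \<le> 1 / (2 * \<mu>) * (norm (w - z))\<^sup>2"
      using \<mu> mult_right_mono[of "2 * \<mu> * L" "norm (w - z)" "norm (w - z)"]
      by (simp add: power2_eq_square pos_le_divide_eq mult_ac)
    moreover have "?h u \<le> ?h z"
      using L0 \<mu> by (intro umin) simp
    ultimately show ?thesis
      using lipschitz_diff_le[OF L, of z w] by (simp add: norm_minus_commute)
  qed (rule umin)
  then show ?thesis
    using u by (auto simp: prox_point_def dist_norm norm_minus_commute)
qed

section \<open>Proximal subgradients of weakly convex functions\<close>

text \<open>Required for all \<open>w\<close> with one fixed \<eta>, not locally with constants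
  depending on \<open>u\<close>; for continuous \<psi> this is a closed condition on the pair of
  \<open>u\<close> and \<open>a\<close>.\<close>

definition proximal_subgradient :: "real \<Rightarrow> ('a::euclidean_space \<Rightarrow> real) \<Rightarrow> 'a \<Rightarrow> 'a \<Rightarrow> bool" where
  "proximal_subgradient \<eta> \<psi> u a \<longleftrightarrow>
     (\<forall>w. \<psi> u + a \<bullet> (w - u) - \<eta> / 2 * (norm (w - u))\<^sup>2 \<le> \<psi> w)"

lemma norm_add_scaleR_squared:
  fixes p d :: "'a::real_inner"
  shows "(norm (p + t *\<^sub>R d))\<^sup>2 = (norm p)\<^sup>2 + 2 * t * (p \<bullet> d) + t\<^sup>2 * (norm d)\<^sup>2"
  unfolding power2_norm_eq_inner
  by (simp add: inner_add_left inner_add_right inner_commute power2_eq_square algebra_simps)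

text \<open>The squares collect through (1 - t) |u|^2 + t |w|^2 - |u + t (w - u)|^2 = t (1 - t) |w -
  u|^2.\<close>

lemma weakly_convex_segment:
  fixes \<psi> :: "'a::euclidean_space \<Rightarrow> real"
  assumes "weakly_convex \<eta> \<psi>" "0 \<le> t" "t \<le> 1"
  shows "\<psi> (u + t *\<^sub>R (w - u))
           \<le> (1 - t) * \<psi> u + t * \<psi> w + \<eta> / 2 * (t * (1 - t)) * (norm (w - u))\<^sup>2"
proof -
  define N where "N = (norm (w - u))\<^sup>2"
  define I where "I = u \<bullet> (w - u)"
  have e: "(1 - t) *\<^sub>R u + t *\<^sub>R w = u + t *\<^sub>R (w - u)"
    by (simp add: algebra_simps)
  have "\<psi> (u + t *\<^sub>R (w - u)) + \<eta> / 2 * (norm (u + t *\<^sub>R (w - u)))\<^sup>2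
      \<le> (1 - t) * (\<psi> u + \<eta> / 2 * (norm u)\<^sup>2) + t * (\<psi> w + \<eta> / 2 * (norm w)\<^sup>2)"
    using convex_onD[of UNIV _ t u w] assms unfolding weakly_convex_def e[symmetric] by blast
  moreover have "(norm w)\<^sup>2 = (norm u)\<^sup>2 + 2 * I + N"
    using norm_add_scaleR_squared[of u 1 "w - u"] by (simp add: I_def N_def)
  moreover have "(norm (u + t *\<^sub>R (w - u)))\<^sup>2 = (norm u)\<^sup>2 + 2 * t * I + t\<^sup>2 * N"
    unfolding norm_add_scaleR_squared I_def N_def ..
  ultimately have "\<psi> (u + t *\<^sub>R (w - u)) \<le> (1 - t) * (\<psi> u + \<eta> / 2 * (norm u)\<^sup>2)
      + t * (\<psi> w + \<eta> / 2 * ((norm u)\<^sup>2 + 2 * I + N)) - \<eta> / 2 * ((norm u)\<^sup>2 + 2 * t * I + t\<^sup>2 * N)"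
    by simp
  also have "\<dots> = (1 - t) * \<psi> u + t * \<psi> w + \<eta> / 2 * (t * (1 - t)) * N"
    by (simp add: field_simps power2_eq_square)
  finally show ?thesis
    unfolding N_def .
qed

text \<open>First-order optimality at \<open>u\<close>: compare \<open>u\<close> with u + t (w - u),
  bound \<psi> there by weak convexity, divide by t and let t decrease to 0.\<close>

lemma prox_point_proximal_subgradient:
  fixes \<psi> :: "'a::euclidean_space \<Rightarrow> real"
  assumes wc: "weakly_convex \<eta> \<psi>" and \<mu>: "\<mu> > 0" and u: "prox_point \<mu> \<psi> z u"
  shows "proximal_subgradient \<eta> \<psi> u ((1 / \<mu>) *\<^sub>R (z - u))"
  unfolding proximal_subgradient_def
proof
  fix w
  define N where "N = (norm (w - u))\<^sup>2"
  define I where "I = (u - z) \<bullet> (w - u)"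
  \<comment> \<open>The claim is 0 \<le> \<open>A\<close>, because \<open>a\<close> paired with w -
    u equals - I / \<mu>; \<open>t * B\<close> gathers the second-order rest of both quadratic terms
    and vanishes in the limit, whatever the sign of \<open>B\<close>.\<close>
  define A where "A = \<psi> w - \<psi> u + \<eta> / 2 * N + I / \<mu>"
  define B where "B = (1 / (2 * \<mu>) - \<eta> / 2) * N"
  have pos: "0 \<le> A + t * B" if t: "0 < t" "t < 1" for t
  proof -
    have "u + t *\<^sub>R (w - u) - z = (u - z) + t *\<^sub>R (w - u)" by simp
    then have n: "(norm (u + t *\<^sub>R (w - u) - z))\<^sup>2 = (norm (u - z))\<^sup>2 + 2 * t * I + t\<^sup>2 * N"
      by (simp only: norm_add_scaleR_squared I_def N_def)
    have "\<psi> u + 1 / (2 * \<mu>) * (norm (u - z))\<^sup>2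
        \<le> \<psi> (u + t *\<^sub>R (w - u)) + 1 / (2 * \<mu>) * ((norm (u - z))\<^sup>2 + 2 * t * I + t\<^sup>2 * N)"
      using u unfolding prox_point_def n[symmetric] by blast
    moreover have "1 / (2 * \<mu>) * ((norm (u - z))\<^sup>2 + 2 * t * I + t\<^sup>2 * N) =
        1 / (2 * \<mu>) * (norm (u - z))\<^sup>2 + t * (I / \<mu>) + t * (t * (1 / (2 * \<mu>)) * N)"
      using \<mu> by (simp add: field_simps power2_eq_square)
    ultimately have "0 \<le> \<psi> (u + t *\<^sub>R (w - u)) - \<psi> u + t * (I / \<mu>) + t * (t * (1 / (2 * \<mu>)) * N)"
      by linarith
    also have "\<dots> \<le> (1 - t) * \<psi> u + t * \<psi> w + \<eta> / 2 * (t * (1 - t)) * N - \<psi> u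
        + t * (I / \<mu>) + t * (t * (1 / (2 * \<mu>)) * N)"
      using weakly_convex_segment[OF wc, of t u w] t by (simp add: N_def)
    also have "\<dots> = t * (A + t * B)"
      unfolding A_def B_def by (simp add: field_simps)
    finally show ?thesis
      using t by (simp add: zero_le_mult_iff)
  qed
  have "((\<lambda>t. A + t * B) \<longlongrightarrow> A + 0 * B) (at_right 0)"
    by (intro tendsto_intros)
  moreover have "\<forall>\<^sub>F t in at_right 0. 0 \<le> A + t * B"
    using eventually_at_right_real[of 0 "1::real"] by (auto elim!: eventually_mono intro: pos)
  ultimately have "0 \<le> A"
    using tendsto_lowerbound[of _ _ "at_right (0::real)" 0] by fastforce
  moreover have "((1 / \<mu>) *\<^sub>R (z - u)) \<bullet> (w - u) = - (I / \<mu>)"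
    by (simp add: I_def inner_diff_left diff_divide_distrib)
  ultimately show "\<psi> u + ((1 / \<mu>) *\<^sub>R (z - u)) \<bullet> (w - u) - \<eta> / 2 * (norm (w - u))\<^sup>2 \<le> \<psi> w"
    by (simp add: A_def N_def)
qed

section \<open>Differentiability of the Moreau envelope and of the surrogate\<close>

text \<open>Upper bound: \<open>u\<close> is a competitor in the infimum at \<open>y\<close>. Lower
  bound: insert the proximal subgradient inequality at \<open>u\<close> for every competitor
  \<open>w\<close>; \<mu> \<eta> \<le> 1/2 absorbs its concave term. The remainder is quadratic, so
  \<open>a\<close> is the gradient at \<open>z\<close>.\<close>

lemma moreau_env_quadratic_bounds:
  fixes \<psi> :: "'a::euclidean_space \<Rightarrow> real"
  assumes L: "L-lipschitz_on UNIV \<psi>" and wc: "weakly_convex \<eta> \<psi>"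
    and \<mu>: "\<mu> > 0" "\<mu> * \<eta> \<le> 1 / 2" and u: "prox_point \<mu> \<psi> z u"
  defines "a \<equiv> (1 / \<mu>) *\<^sub>R (z - u)"
  shows "\<bar>moreau_env \<mu> \<psi> y - moreau_env \<mu> \<psi> z - a \<bullet> (y - z)\<bar> \<le> (norm (y - z))\<^sup>2 / (2 * \<mu>)"
proof -
  define e where "e = y - z"
  have ua: "u = z - \<mu> *\<^sub>R a"
    using \<mu> by (simp add: a_def)
  have env: "moreau_env \<mu> \<psi> z = \<psi> u + \<mu> / 2 * (norm a)\<^sup>2"
    using \<mu> unfolding moreau_env_prox_point[OF u] ua by (simp add: power2_eq_square)
  \<comment> \<open>Since y = u + \<mu> a + e, expanding around w - u - e isolates the linear term
    in \<open>a\<close> that cancels against the subgradient inequality.\<close>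
  have sq: "1 / (2 * \<mu>) * (norm (w - y))\<^sup>2
      = (norm (w - u - e))\<^sup>2 / (2 * \<mu>) - a \<bullet> (w - u) + a \<bullet> e + \<mu> / 2 * (norm a)\<^sup>2" for w
  proof -
    have "w - y = (w - u - e) + (- \<mu>) *\<^sub>R a"
      by (simp add: ua e_def algebra_simps)
    then have n: "(norm (w - y))\<^sup>2 = (norm (w - u - e))\<^sup>2 - 2 * \<mu> * ((w - u - e) \<bullet> a) + \<mu>\<^sup>2 * (norm a)\<^sup>2"
      by (simp only: norm_add_scaleR_squared) simp
    have "1 / (2 * \<mu>) * (norm (w - y))\<^sup>2
        = (norm (w - u - e))\<^sup>2 / (2 * \<mu>) - (w - u - e) \<bullet> a + \<mu> / 2 * (norm a)\<^sup>2"
      unfolding n using \<mu> by (simp add: add_divide_distrib diff_divide_distrib power2_eq_square)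
    moreover have "(w - u - e) \<bullet> a = a \<bullet> (w - u) - a \<bullet> e"
      by (simp add: inner_commute inner_diff_right)
    ultimately show ?thesis
      by linarith
  qed
  have "moreau_env \<mu> \<psi> y \<le> \<psi> u + 1 / (2 * \<mu>) * (norm (u - y))\<^sup>2"
    by (rule moreau_env_le[OF L \<mu>(1)])
  then have up: "moreau_env \<mu> \<psi> y \<le> moreau_env \<mu> \<psi> z + a \<bullet> e + (norm e)\<^sup>2 / (2 * \<mu>)"
    unfolding sq env by simp
  have "moreau_env \<mu> \<psi> z + a \<bullet> e - (norm e)\<^sup>2 / (2 * \<mu>) \<le> \<psi> w + 1 / (2 * \<mu>) * (norm (w - y))\<^sup>2" for w
  proof -
    define d where "d = w - u"
    have "\<psi> u + a \<bullet> d - \<eta> / 2 * (norm d)\<^sup>2 \<le> \<psi> w"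
      using prox_point_proximal_subgradient[OF wc \<mu>(1) u]
      unfolding proximal_subgradient_def a_def d_def by blast
    moreover have "\<eta> / 2 * (norm d)\<^sup>2 \<le> ((norm (d - e))\<^sup>2 + (norm e)\<^sup>2) / (2 * \<mu>)"
    proof -
      \<comment> \<open>|d - 2 e|^2 is exactly 2 (|d - e|^2 + |e|^2) - |d|^2.\<close>
      have "0 \<le> (norm (d + (- 2) *\<^sub>R e))\<^sup>2" by simp
      then have "(norm d)\<^sup>2 \<le> 2 * ((norm (d - e))\<^sup>2 + (norm e)\<^sup>2)"
        unfolding norm_add_scaleR_squared
        using norm_add_scaleR_squared[of d "- 1" e] by simp
      moreover have "\<mu> * \<eta> * (norm d)\<^sup>2 \<le> 1 / 2 * (norm d)\<^sup>2"
        using \<mu> by (intro mult_right_mono) auto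
      ultimately have "\<mu> * \<eta> * (norm d)\<^sup>2 \<le> (norm (d - e))\<^sup>2 + (norm e)\<^sup>2" by argo
      then show ?thesis
        using \<mu> by (simp add: field_simps)
    qed
    ultimately show ?thesis
      unfolding sq env d_def[symmetric] by (simp add: add_divide_distrib)
  qed
  then have "moreau_env \<mu> \<psi> z + a \<bullet> e - (norm e)\<^sup>2 / (2 * \<mu>) \<le> moreau_env \<mu> \<psi> y"
    unfolding moreau_env_def[of \<mu> \<psi> y] by (intro cINF_greatest) auto
  with up show ?thesis
    unfolding e_def by linarith
qed

lemma has_derivative_quadratic_remainder:
  fixes h :: "'a::euclidean_space \<Rightarrow> real"
  assumes bound: "\<And>y. \<bar>h y - h z - a \<bullet> (y - z)\<bar> \<le> C * (norm (y - z))\<^sup>2"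
  shows "(h has_derivative (\<lambda>v. a \<bullet> v)) (at z)"
  unfolding has_derivative_within
proof (intro conjI bounded_linear_inner_right)
  show "((\<lambda>y. (1 / norm (y - z)) *\<^sub>R (h y - (h z + a \<bullet> (y - z)))) \<longlongrightarrow> 0) (at z)"
  proof (rule Lim_null_comparison)
    have "norm ((1 / norm (y - z)) *\<^sub>R (h y - (h z + a \<bullet> (y - z)))) \<le> C * norm (y - z)" if "y \<noteq> z" for y
      using bound[of y] that by (simp add: field_simps power2_eq_square)
    then show "\<forall>\<^sub>F y in at z. norm ((1 / norm (y - z)) *\<^sub>R (h y - (h z + a \<bullet> (y - z)))) \<le> C * norm (y - z)"
      by (auto simp: eventually_at_filter)
    have "((\<lambda>y. C * norm (y - z)) \<longlongrightarrow> C * norm (z - z)) (at z)"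
      by (intro tendsto_intros)
    then show "((\<lambda>y. C * norm (y - z)) \<longlongrightarrow> 0) (at z)" by simp
  qed
qed

lemma moreau_env_has_derivative:
  fixes \<psi> :: "'a::euclidean_space \<Rightarrow> real"
  assumes "L-lipschitz_on UNIV \<psi>" "weakly_convex \<eta> \<psi>" "\<mu> > 0" "\<mu> * \<eta> \<le> 1 / 2" "prox_point \<mu> \<psi> z u"
  shows "(moreau_env \<mu> \<psi> has_derivative (\<lambda>v. ((1 / \<mu>) *\<^sub>R (z - u)) \<bullet> v)) (at z)"
  using moreau_env_quadratic_bounds[OF assms]
  by (intro has_derivative_quadratic_remainder[where C = "1 / (2 * \<mu>)"]) simp

lemma grad_eqI:
  assumes "GDERIV h x :> D"
  shows "grad h x = D"
  unfolding grad_def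
proof (rule the_equality)
  fix D' assume "GDERIV h x :> D'"
  with assms have "(\<lambda>v. v \<bullet> D') = (\<lambda>v. v \<bullet> D)"
    unfolding gderiv_def by (rule has_derivative_unique[rotated])
  then show "D' = D"
    by (metis vector_eq_ldot)
qed (rule assms)

text \<open>The Riesz vector of the functional \<open>h'\<close> is \<open>adjoint h' 1\<close>.
  This links the definite description in \<open>grad\<close> to the derivative rules.\<close>

lemma grad_inner:
  fixes h :: "'a::euclidean_space \<Rightarrow> real"
  assumes "(h has_derivative h') (at x)"
  shows "grad h x \<bullet> v = h' v"
proof -
  have lin: "linear h'"
    using assms has_derivative_linear by blast
  have eq: "h' = (\<lambda>v. v \<bullet> adjoint h' 1)"
    using adjoint_works[OF lin] by (simp add: fun_eq_iff)
  then have "GDERIV h x :> adjoint h' 1"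
    using assms unfolding gderiv_def by simp
  then have "grad h x = adjoint h' 1"
    by (rule grad_eqI)
  then show ?thesis
    by (metis eq inner_commute)
qed

text \<open>Chain rule, tested against a vector \<open>v\<close>, so that limits can be taken for
  each \<open>v\<close> separately without adjoints of varying derivatives.\<close>

lemma surrogate_grad_inner:
  fixes f g :: "'b::euclidean_space \<Rightarrow> real" and S :: "'a::euclidean_space \<Rightarrow> 'b"
  assumes f: "Lf-lipschitz_on UNIV f" "weakly_convex \<eta>f f" "\<mu> * \<eta>f \<le> 1 / 2" "prox_point \<mu> f (S x) u"
    and g: "Lg-lipschitz_on UNIV g" "weakly_convex \<eta>g g" "\<mu> * \<eta>g \<le> 1 / 2" "prox_point \<mu> g (S x) w"
    and \<mu>: "\<mu> > 0" and S: "(S has_derivative S') (at x)"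
  shows "grad (surrogate f g S \<mu>) x \<bullet> v = ((1 / \<mu>) *\<^sub>R (S x - u) - (1 / \<mu>) *\<^sub>R (S x - w)) \<bullet> S' v"
proof -
  have "((\<lambda>y. moreau_env \<mu> f (S y) - moreau_env \<mu> g (S y)) has_derivative
      (\<lambda>v. ((1 / \<mu>) *\<^sub>R (S x - u)) \<bullet> S' v - ((1 / \<mu>) *\<^sub>R (S x - w)) \<bullet> S' v)) (at x)"
    by (intro has_derivative_diff has_derivative_compose[OF S]
        moreau_env_has_derivative[OF f(1,2) \<mu> f(3,4)] moreau_env_has_derivative[OF g(1,2) \<mu> g(3,4)])
  then show ?thesis
    using grad_inner[of "surrogate f g S \<mu>" _ x v]
    by (simp add: surrogate_def[abs_def] inner_diff_left)
qed

section \<open>Frechet and limiting subdifferentials of compositions\<close>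

text \<open>Any extended real below 0 lies below some real s < 0; the hypothesis with e = - s then
  keeps the difference quotient at or above s near \<open>x\<close>.\<close>

lemma frechet_subdifferentialI:
  fixes \<psi> :: "'a::euclidean_space \<Rightarrow> real"
  assumes "\<And>e. e > 0 \<Longrightarrow> \<forall>\<^sub>F y in at x. - (e * norm (y - x)) \<le> \<psi> y - \<psi> x - w \<bullet> (y - x)"
  shows "w \<in> frechet_subdifferential \<psi> x"
proof -
  have "\<forall>\<^sub>F y in at x. r < ereal ((\<psi> y - \<psi> x - w \<bullet> (y - x)) / norm (y - x))" if r: "r < 0" for r :: ereal
  proof -
    obtain s where s: "r < ereal s" "s < 0"
      using ereal_dense2[OF r] by (auto simp: zero_ereal_def)
    have "\<forall>\<^sub>F y in at x. y \<noteq> x"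
      by (simp add: eventually_at_filter)
    moreover have "\<forall>\<^sub>F y in at x. s * norm (y - x) \<le> \<psi> y - \<psi> x - w \<bullet> (y - x)"
      using assms[of "- s"] s(2) by simp
    ultimately have "\<forall>\<^sub>F y in at x. s \<le> (\<psi> y - \<psi> x - w \<bullet> (y - x)) / norm (y - x)"
      by eventually_elim (simp add: pos_le_divide_eq)
    then show ?thesis
      by eventually_elim (use s(1) in \<open>auto intro: less_le_trans\<close>)
  qed
  then show ?thesis
    unfolding frechet_subdifferential_def by (simp add: le_Liminf_iff)
qed

lemma frechet_subset_limiting_subdifferential:
  "frechet_subdifferential \<psi> x \<subseteq> limiting_subdifferential \<psi> x"
proof
  fix w assume "w \<in> frechet_subdifferential \<psi> x"
  then show "w \<in> limiting_subdifferential \<psi> x"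
    unfolding limiting_subdifferential_def mem_Collect_eq
    by (intro exI[of _ "\<lambda>_::nat. x"] exI[of _ "\<lambda>_::nat. w"]) simp
qed

text \<open>Composing the quadratic minorant with \<open>S\<close> gives a minorant of \<psi> o S
  that touches at \<open>p\<close> and is differentiable there; its gradient at \<open>p\<close> is
  a Frechet subgradient.\<close>

lemma proximal_subgradient_chain_rule:
  fixes \<psi> :: "'b::euclidean_space \<Rightarrow> real" and S :: "'a::euclidean_space \<Rightarrow> 'b"
  assumes a: "proximal_subgradient \<eta> \<psi> (S p) a" and S: "(S has_derivative S') (at p)"
  shows "adjoint S' a \<in> frechet_subdifferential (\<psi> \<circ> S) p"
proof (rule frechet_subdifferentialI)
  fix e :: real assume e: "e > 0"
  \<comment> \<open>Up to an additive constant this is the minorant; its squared term has zero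
    derivative at \<open>p\<close>.\<close>
  define h where "h = (\<lambda>y. a \<bullet> S y - \<eta> / 2 * (norm (S y - S p))\<^sup>2)"
  have "(h has_derivative (\<lambda>v. a \<bullet> S' v)) (at p)"
    unfolding h_def power2_norm_eq_inner
    by (rule derivative_eq_intros S refl | simp)+
  then obtain d where d: "d > 0"
    "\<And>y. norm (y - p) < d \<Longrightarrow> norm (h y - h p - a \<bullet> S' (y - p)) \<le> e * norm (y - p)"
    using e unfolding has_derivative_at_alt by blast
  have "- (e * norm (y - p)) \<le> (\<psi> \<circ> S) y - (\<psi> \<circ> S) p - adjoint S' a \<bullet> (y - p)" if "norm (y - p) < d" for y
  proof -
    have "adjoint S' a \<bullet> (y - p) = a \<bullet> S' (y - p)"
      using adjoint_works[OF has_derivative_linear[OF S]] by (metis inner_commute)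
    moreover have "\<psi> (S p) + h y - h p \<le> \<psi> (S y)"
      using a[unfolded proximal_subgradient_def, rule_format, of "S y"]
      by (simp add: h_def inner_diff_right)
    ultimately show ?thesis
      using d(2)[OF that] by simp
  qed
  then show "\<forall>\<^sub>F y in at p. - (e * norm (y - p)) \<le> (\<psi> \<circ> S) y - (\<psi> \<circ> S) p - adjoint S' a \<bullet> (y - p)"
    unfolding eventually_at dist_norm using d(1) by blast
qed

lemma proximal_subgradient_closed:
  fixes \<psi> :: "'a::euclidean_space \<Rightarrow> real"
  assumes "\<And>k. proximal_subgradient \<eta> \<psi> (u k) (a k)"
    and "u \<longlonglongrightarrow> z" "a \<longlonglongrightarrow> b" "continuous_on UNIV \<psi>"
  shows "proximal_subgradient \<eta> \<psi> z b"
  unfolding proximal_subgradient_def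
proof
  fix w
  have "(\<lambda>k. \<psi> (u k)) \<longlonglongrightarrow> \<psi> z"
    using assms(2,4) by (auto intro: continuous_on_tendsto_compose)
  then have "(\<lambda>k. \<psi> (u k) + a k \<bullet> (w - u k) - \<eta> / 2 * (norm (w - u k))\<^sup>2)
      \<longlonglongrightarrow> \<psi> z + b \<bullet> (w - z) - \<eta> / 2 * (norm (w - z))\<^sup>2"
    using assms(2,3) by (intro tendsto_intros)
  then show "\<psi> z + b \<bullet> (w - z) - \<eta> / 2 * (norm (w - z))\<^sup>2 \<le> \<psi> w"
    by (rule LIMSEQ_le_const2) (use assms(1) in \<open>auto simp: proximal_subgradient_def\<close>)
qed

section \<open>Criticality of limit points\<close>

text \<open>Here \<mu> and \<open>y\<close> stand for sequences already restricted to a convergent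
  subsequence, so the index set is all of the naturals, including 0.\<close>

lemma dc_composite_critical_limit:
  fixes f g :: "'b::euclidean_space \<Rightarrow> real" and S :: "'a::euclidean_space \<Rightarrow> 'b"
    and DS :: "'a \<Rightarrow> 'a \<Rightarrow>\<^sub>L 'b"
  assumes f: "Lf-lipschitz_on UNIV f" "weakly_convex \<eta>f f"
    and g: "Lg-lipschitz_on UNIV g" "weakly_convex \<eta>g g"
    and S: "\<And>y. (S has_derivative blinfun_apply (DS y)) (at y)" and DS: "continuous_on UNIV DS"
    and \<mu>: "\<And>k. \<mu> k > 0" "\<And>k. \<mu> k * \<eta>f \<le> 1 / 2" "\<And>k. \<mu> k * \<eta>g \<le> 1 / 2" "\<mu> \<longlonglongrightarrow> 0"
    and y: "y \<longlonglongrightarrow> p" and G: "(\<lambda>k. norm (grad (surrogate f g S (\<mu> k)) (y k))) \<longlonglongrightarrow> 0"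
  shows "dc_composite_critical f g S p"
proof -
  obtain u where u: "\<And>k. prox_point (\<mu> k) f (S (y k)) (u k)" "\<And>k. norm (u k - S (y k)) \<le> 2 * \<mu> k * Lf"
    using choice[OF allI[OF prox_point_exists[OF f(1) \<mu>(1)]], of "\<lambda>k. k" "\<lambda>k. S (y k)"] by auto
  obtain w where w: "\<And>k. prox_point (\<mu> k) g (S (y k)) (w k)" "\<And>k. norm (w k - S (y k)) \<le> 2 * \<mu> k * Lg"
    using choice[OF allI[OF prox_point_exists[OF g(1) \<mu>(1)]], of "\<lambda>k. k" "\<lambda>k. S (y k)"] by auto
  define a where "a k = (1 / \<mu> k) *\<^sub>R (S (y k) - u k)" for k
  define b where "b k = (1 / \<mu> k) *\<^sub>R (S (y k) - w k)" for k
  have Sy: "(\<lambda>k. S (y k)) \<longlonglongrightarrow> S p"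
    using y S isCont_tendsto_compose has_derivative_continuous by blast
  \<comment> \<open>Proximal points stay within a multiple of \<open>\<mu> k\<close> of
    \<open>S (y k)\<close>, so they share its limit.\<close>
  have conv: "v \<longlonglongrightarrow> S p" if "\<And>k. norm (v k - S (y k)) \<le> 2 * \<mu> k * L" for v L
  proof -
    have "(\<lambda>k. 2 * \<mu> k * L) \<longlonglongrightarrow> 2 * 0 * L"
      by (intro tendsto_mult tendsto_const \<mu>(4))
    then have "(\<lambda>k. 2 * \<mu> k * L) \<longlonglongrightarrow> 0" by simp
    then have "(\<lambda>k. v k - S (y k)) \<longlonglongrightarrow> 0"
      by (rule Lim_null_comparison[OF always_eventually, rotated]) (rule allI, rule that)
    from tendsto_add[OF this Sy] show ?thesis by simp
  qed
  have bd: "norm ((1 / \<mu> k) *\<^sub>R (S (y k) - v)) \<le> 2 * L" if "norm (v - S (y k)) \<le> 2 * \<mu> k * L" for v L k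
    using that \<mu>(1)[of k] by (simp add: pos_divide_le_eq norm_minus_commute mult_ac)
  \<comment> \<open>Working with pairs yields one subsequence along which both envelope gradients
    converge.\<close>
  have "bounded (range (\<lambda>k. (a k, b k)))"
  proof (rule bounded_subset)
    show "range (\<lambda>k. (a k, b k)) \<subseteq> cball 0 (2 * Lf) \<times> cball 0 (2 * Lg)"
      using bd[OF u(2)] bd[OF w(2)] by (auto simp: a_def b_def)
  qed (intro bounded_Times bounded_cball)
  then obtain ab r where r: "strict_mono (r :: nat \<Rightarrow> nat)" "((\<lambda>k. (a k, b k)) \<circ> r) \<longlonglongrightarrow> ab"
    using bounded_imp_convergent_subsequence by blast
  obtain a' b' where ab: "ab = (a', b')" by fastforce
  have a': "(\<lambda>k. a (r k)) \<longlonglongrightarrow> a'" and b': "(\<lambda>k. b (r k)) \<longlonglongrightarrow> b'"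
    using tendsto_fst[OF r(2)] tendsto_snd[OF r(2)] by (simp_all add: ab o_def)
  have ps_a: "proximal_subgradient \<eta>f f (S p) a'"
  proof (rule proximal_subgradient_closed[OF _ _ a'])
    show "proximal_subgradient \<eta>f f (u (r k)) (a (r k))" for k
      unfolding a_def by (rule prox_point_proximal_subgradient[OF f(2) \<mu>(1) u(1)])
    show "(\<lambda>k. u (r k)) \<longlonglongrightarrow> S p"
      using LIMSEQ_subseq_LIMSEQ[OF conv[OF u(2)] r(1)] by (simp add: o_def)
  qed (rule lipschitz_on_continuous_on[OF f(1)])
  have ps_b: "proximal_subgradient \<eta>g g (S p) b'"
  proof (rule proximal_subgradient_closed[OF _ _ b'])
    show "proximal_subgradient \<eta>g g (w (r k)) (b (r k))" for k
      unfolding b_def by (rule prox_point_proximal_subgradient[OF g(2) \<mu>(1) w(1)])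
    show "(\<lambda>k. w (r k)) \<longlonglongrightarrow> S p"
      using LIMSEQ_subseq_LIMSEQ[OF conv[OF w(2)] r(1)] by (simp add: o_def)
  qed (rule lipschitz_on_continuous_on[OF g(1)])
  \<comment> \<open>By Cauchy-Schwarz the pairing with \<open>DS (y k) v\<close> is at most the norm
    of the surrogate gradient times |v|, which tends to 0; continuity of \<open>DS\<close>
    identifies the same limit at \<open>p\<close>.\<close>
  have zero: "(a' - b') \<bullet> DS p v = 0" for v
  proof -
    have "(\<lambda>k. (a (r k) - b (r k)) \<bullet> DS (y (r k)) v) \<longlonglongrightarrow> (a' - b') \<bullet> DS p v"
    proof (intro tendsto_intros a' b')
      have "(\<lambda>k. y (r k)) \<longlonglongrightarrow> p"
        using LIMSEQ_subseq_LIMSEQ[OF y r(1)] by (simp add: o_def)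
      then show "(\<lambda>k. DS (y (r k))) \<longlonglongrightarrow> DS p"
        using DS by (auto intro: continuous_on_tendsto_compose)
    qed
    moreover have "(\<lambda>k. (a (r k) - b (r k)) \<bullet> DS (y (r k)) v) \<longlonglongrightarrow> 0"
    proof (rule Lim_null_comparison)
      have "norm ((a k - b k) \<bullet> DS (y k) v) \<le> norm (grad (surrogate f g S (\<mu> k)) (y k)) * norm v" for k
        using Cauchy_Schwarz_ineq2[of "grad (surrogate f g S (\<mu> k)) (y k)" v]
        unfolding surrogate_grad_inner[OF f \<mu>(2) u(1) g \<mu>(3) w(1) \<mu>(1) S] a_def b_def real_norm_def .
      then show "\<forall>\<^sub>F k in sequentially. norm ((a (r k) - b (r k)) \<bullet> DS (y (r k)) v)
          \<le> norm (grad (surrogate f g S (\<mu> (r k))) (y (r k))) * norm v"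
        by simp
      show "(\<lambda>k. norm (grad (surrogate f g S (\<mu> (r k))) (y (r k))) * norm v) \<longlonglongrightarrow> 0"
        using tendsto_mult_right[OF LIMSEQ_subseq_LIMSEQ[OF G r(1)], of "norm v"] by (simp add: o_def)
    qed
    ultimately show ?thesis
      by (rule LIMSEQ_unique)
  qed
  have lin: "linear (blinfun_apply (DS p))"
    using S has_derivative_linear by blast
  \<comment> \<open>This common vector lies in both subdifferentials, so 0 is a difference of their
    elements.\<close>
  have "adjoint (DS p) a' = adjoint (DS p) b'"
  proof (rule vector_eq_ldot[THEN iffD1], rule allI)
    fix v
    show "v \<bullet> adjoint (DS p) a' = v \<bullet> adjoint (DS p) b'"
      using zero[of v] by (simp add: adjoint_works[OF lin] inner_diff_left inner_commute)
  qed
  moreover have "adjoint (DS p) a' \<in> limiting_subdifferential (f \<circ> S) p"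
    using proximal_subgradient_chain_rule[OF ps_a S] frechet_subset_limiting_subdifferential by blast
  moreover have "adjoint (DS p) b' \<in> limiting_subdifferential (g \<circ> S) p"
    using proximal_subgradient_chain_rule[OF ps_b S] frechet_subset_limiting_subdifferential by blast
  ultimately show ?thesis
    unfolding dc_composite_critical_def by force
qed

section \<open>Armijo condition and backtracking\<close>

text \<open>For a gradient step the descent inequality guarantees a decrease of \<gamma> (1 -
  \<gamma> K / 2) times the squared gradient norm, and 1 - \<gamma> K / 2 \<ge> c is the bound on
  \<gamma>.\<close>

lemma armijo_if_small:
  fixes h :: "'a::euclidean_space \<Rightarrow> real"
  assumes descent: "\<And>y. h y \<le> h x + grad h x \<bullet> (y - x) + K / 2 * (norm (y - x))\<^sup>2"
    and "0 < \<gamma>" "\<gamma> * K \<le> 2 * (1 - c)"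
  shows "armijo h x c \<gamma>"
proof -
  let ?n = "(norm (grad h x))\<^sup>2"
  have "h (x - \<gamma> *\<^sub>R grad h x) \<le> h x - \<gamma> * ?n + K / 2 * (\<gamma>\<^sup>2 * ?n)"
    using descent[of "x - \<gamma> *\<^sub>R grad h x"]
    by (simp add: power2_norm_eq_inner power_mult_distrib)
  also have "\<dots> = h x - c * \<gamma> * ?n - \<gamma> * ?n * ((2 * (1 - c) - \<gamma> * K) / 2)"
    by (simp add: algebra_simps power2_eq_square diff_divide_distrib)
  also have "\<dots> \<le> h x - c * \<gamma> * ?n"
    using assms(2,3) by simp
  finally show ?thesis
    unfolding armijo_def .
qed

text \<open>Every positive trial up to T = 2 (1 - c) / K is accepted. Hence either the initial step
  is accepted, or the last rejected trial exceeds T and the output exceeds \<rho> T.\<close>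

lemma backtracking_stepsize:
  fixes h :: "'a::euclidean_space \<Rightarrow> real"
  assumes descent: "\<And>y. h y \<le> h x + grad h x \<bullet> (y - x) + K / 2 * (norm (y - x))\<^sup>2"
    and K: "K > 0" and \<gamma>0: "\<gamma>0 > 0" and \<rho>: "0 < \<rho>" "\<rho> < 1" and c: "c < 1"
  defines "\<gamma> \<equiv> backtracking h x \<gamma>0 \<rho> c"
  shows "armijo h x c \<gamma> \<and> min \<gamma>0 (\<rho> * (2 * (1 - c) / K)) \<le> \<gamma>"
proof -
  define T where "T = 2 * (1 - c) / K"
  have T: "T > 0" using K c by (simp add: T_def)
  have arm: "armijo h x c s" if "0 < s" "s \<le> T" for s
    using armijo_if_small[OF descent that(1)] that(2) K by (simp add: T_def field_simps)
  \<comment> \<open>The number of reductions that bring \<open>s\<close> down to at most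
    \<open>T\<close>; it is the termination measure of the loop.\<close>
  define N where "N s = (LEAST n. \<rho> ^ n * s \<le> T)" for s
  have ex: "\<exists>n. \<rho> ^ n * s \<le> T" if s: "s > 0" for s
  proof -
    obtain n where "\<rho> ^ n < T / s"
      using real_arch_pow_inv[of "T / s" \<rho>] divide_pos_pos[OF T s] \<rho>(2) by blast
    then show ?thesis
      using s by (auto simp: field_simps intro!: exI[of _ n])
  qed
  have dec: "N (\<rho> * s) < N s" if s: "s > 0" "T < s" for s
  proof -
    have *: "\<rho> ^ N s * s \<le> T"
      unfolding N_def using ex[OF s(1)] by (rule LeastI_ex)
    then obtain m where m: "N s = Suc m"
      using s by (cases "N s") auto
    have "N (\<rho> * s) \<le> m"
      unfolding N_def[of "\<rho> * s"] using * m by (intro Least_le) (simp add: mult_ac)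
    then show ?thesis using m by simp
  qed
  show ?thesis
    unfolding \<gamma>_def backtracking_def T_def[symmetric]
  proof (rule while_rule[where P = "\<lambda>s. 0 < s \<and> min \<gamma>0 (\<rho> * T) \<le> s" and r = "Wellfounded.measure N"])
    fix s assume s: "0 < s \<and> min \<gamma>0 (\<rho> * T) \<le> s" "\<not> armijo h x c s"
    \<comment> \<open>Rejection forces \<open>s\<close> above \<open>T\<close>: this preserves the
      lower bound for \<open>\<rho> * s\<close> and makes \<open>N\<close> drop.\<close>
    then have big: "T < s" using arm by force
    then show "0 < \<rho> * s \<and> min \<gamma>0 (\<rho> * T) \<le> \<rho> * s"
      using s \<rho> by (auto simp: min_def intro: order.trans mult_left_mono)
    show "(\<rho> * s, s) \<in> Wellfounded.measure N"
      using dec s(1) big by simp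
  qed (use \<gamma>0 in auto)
qed

section \<open>Lower bound and summed descent of the energy\<close>

text \<open>The envelope of \<open>f\<close> lies at most \<mu> Lf^2 / 2 below \<open>f\<close>,
  while that of \<open>g\<close> does not exceed \<open>g\<close>; thus the energy is bounded below
  by inf F.\<close>

lemma surrogate_ge:
  assumes "Lf-lipschitz_on UNIV f" "Lg-lipschitz_on UNIV g" "\<mu> > 0"
  shows "dc_objective f g S x \<le> surrogate f g S \<mu> x + \<mu> * Lf\<^sup>2 / 2"
  using moreau_env_ge[OF assms(1,3), of "S x"] moreau_env_le_self[OF assms(2,3), of "S x"]
  unfolding dc_objective_def surrogate_def by linarith

text \<open>The correction term pays for the growth of the envelope of \<open>f\<close>; the
  envelope of \<open>g\<close> also grows, but enters with a minus sign.\<close>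

lemma surrogate_shrink_parameter:
  assumes "Lf-lipschitz_on UNIV f" "Lg-lipschitz_on UNIV g" "0 < \<nu>" "\<nu> \<le> \<mu>"
  shows "surrogate f g S \<nu> x + \<nu> * Lf\<^sup>2 / 2 \<le> surrogate f g S \<mu> x + \<mu> * Lf\<^sup>2 / 2"
  using moreau_env_lipschitz_parameter[OF assms(1,3,4), of "S x"] moreau_env_antimono[OF assms(2-4), of "S x"]
  unfolding surrogate_def by (simp add: algebra_simps diff_divide_distrib)

text \<open>Turns stepsize bounds of order 1 / \<kappa> into bounds linear in \<mu>, through 1 /
  \<kappa> = \<mu> / (\<omega>1 \<mu> + \<omega>2).\<close>

lemma inverse_kappa_ge:
  assumes "\<omega>1 > 0" "\<omega>2 > 0" "0 < \<mu>" "\<mu> \<le> M"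
  shows "\<mu> / (\<omega>1 * M + \<omega>2) \<le> inverse (kappa \<omega>1 \<omega>2 \<mu>)"
proof -
  have "inverse (kappa \<omega>1 \<omega>2 \<mu>) = \<mu> / (\<omega>1 * \<mu> + \<omega>2)"
    using assms by (simp add: kappa_def field_simps)
  moreover have "\<mu> / (\<omega>1 * M + \<omega>2) \<le> \<mu> / (\<omega>1 * \<mu> + \<omega>2)"
    using assms by (intro divide_left_mono add_right_mono mult_left_mono mult_pos_pos add_pos_pos) auto
  ultimately show ?thesis by simp
qed

text \<open>The descent telescopes from 1 to b; the summands are nonnegative, so starting at a only
  lowers the sum.\<close>

lemma weighted_sum_le_of_descent:
  fixes E \<mu> G :: "nat \<Rightarrow> real"
  assumes dec: "\<And>k. k \<ge> 1 \<Longrightarrow> E (Suc k) \<le> E k - \<tau> * \<mu> k * (G k)\<^sup>2" and lower: "\<And>k. k \<ge> 1 \<Longrightarrow> l \<le> E k"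
    and \<tau>: "\<tau> > 0" and \<mu>: "\<And>k. k \<ge> 1 \<Longrightarrow> \<mu> k > 0" and ab: "1 \<le> a" "a \<le> b"
  shows "(\<Sum>k=a..b. \<mu> k * (G k)\<^sup>2) \<le> (E 1 - l) / \<tau>"
proof -
  have nn: "0 \<le> \<mu> k * (G k)\<^sup>2" if "k \<ge> 1" for k
    using \<mu>[OF that] by simp
  have "(\<Sum>k=a..b. \<mu> k * (G k)\<^sup>2) \<le> (\<Sum>k=1..b. \<mu> k * (G k)\<^sup>2)"
    using ab nn by (intro sum_mono2) auto
  also have "\<dots> \<le> (E 1 - l) / \<tau>"
  proof -
    have "\<tau> * (\<Sum>k=1..n. \<mu> k * (G k)\<^sup>2) \<le> E 1 - E (Suc n)" for n
    proof (induction n)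
      case (Suc n)
      then show ?case using dec[of "Suc n"] by (simp add: algebra_simps)
    qed simp
    from this[of b] lower[of "Suc b"] have "\<tau> * (\<Sum>k=1..b. \<mu> k * (G k)\<^sup>2) \<le> E 1 - l"
      by simp
    then show ?thesis
      using \<tau> by (simp add: pos_le_divide_eq mult.commute)
  qed
  finally show ?thesis .
qed

section \<open>From a bounded weighted sum to the rate and a vanishing subsequence\<close>

text \<open>The squared minimum is at most the \<mu>-weighted mean of the squares.\<close>

lemma Min_le_sqrt_weighted_mean:
  fixes G \<mu> :: "nat \<Rightarrow> real"
  assumes "a \<le> b" "\<And>k. k \<in> {a..b} \<Longrightarrow> \<mu> k > 0" "\<And>k. G k \<ge> 0" "(\<Sum>k=a..b. \<mu> k * (G k)\<^sup>2) \<le> C"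
  shows "(MIN k\<in>{a..b}. G k) \<le> sqrt (C / (\<Sum>k=a..b. \<mu> k))"
proof (rule real_le_rsqrt)
  let ?m = "MIN k\<in>{a..b}. G k"
  have m0: "0 \<le> ?m" using assms(1,3) by simp
  have "?m\<^sup>2 * (\<Sum>k=a..b. \<mu> k) \<le> (\<Sum>k=a..b. \<mu> k * (G k)\<^sup>2)"
    unfolding sum_distrib_left
  proof (rule sum_mono)
    fix k assume k: "k \<in> {a..b}"
    have "?m\<^sup>2 \<le> (G k)\<^sup>2" using k m0 by (intro power_mono) auto
    then show "?m\<^sup>2 * \<mu> k \<le> \<mu> k * (G k)\<^sup>2"
      using assms(2)[OF k] by (simp add: mult.commute)
  qed
  moreover have "(\<Sum>k=a..b. \<mu> k) > 0"
    using assms(1,2) by (intro sum_pos) auto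
  ultimately show "?m\<^sup>2 \<le> C / (\<Sum>k=a..b. \<mu> k)"
    using assms(4) by (simp add: field_simps)
qed

text \<open>If \<open>G\<close> stayed at or above \<open>e\<close> from \<open>K\<close> on, then
  e^2 times the tails of the sum of \<mu> would remain below \<open>C\<close>, against
  divergence.\<close>

lemma frequently_small_of_weighted_sum:
  fixes G \<mu> :: "nat \<Rightarrow> real"
  assumes bound: "\<And>a b. 1 \<le> a \<Longrightarrow> a \<le> b \<Longrightarrow> (\<Sum>k=a..b. \<mu> k * (G k)\<^sup>2) \<le> C"
    and div: "filterlim (\<lambda>N. \<Sum>k=1..N. \<mu> k) at_top sequentially"
    and \<mu>: "\<And>k. k \<ge> 1 \<Longrightarrow> \<mu> k > 0" and e: "e > 0"
  shows "\<exists>k\<ge>K. G k < e"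
proof (rule ccontr)
  assume "\<not> ?thesis"
  then have big: "e \<le> G k" if "k \<ge> K" for k using that by force
  \<comment> \<open>The successor makes \<open>a\<close> at least 1 even for \<open>K = 0\<close>,
    as \<open>bound\<close> requires, and separates the tail from \<open>{1..K}\<close>.\<close>
  define a where "a = Suc K"
  have "\<forall>\<^sub>F N in sequentially. (\<Sum>k=1..K. \<mu> k) + C / e\<^sup>2 + 1 \<le> (\<Sum>k=1..N. \<mu> k)"
    using div by (simp add: filterlim_at_top)
  then obtain N where N: "N \<ge> a" "(\<Sum>k=1..K. \<mu> k) + C / e\<^sup>2 + 1 \<le> (\<Sum>k=1..N. \<mu> k)"
    by (metis eventually_sequentially le_cases)
  have "{1..N} = {1..K} \<union> {a..N}" using N(1) by (auto simp: a_def)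
  then have "(\<Sum>k=1..N. \<mu> k) = (\<Sum>k=1..K. \<mu> k) + (\<Sum>k=a..N. \<mu> k)"
    by (simp add: sum.union_disjoint a_def)
  then have "C / e\<^sup>2 < (\<Sum>k=a..N. \<mu> k)" using N(2) by simp
  then have "C < (\<Sum>k=a..N. \<mu> k) * e\<^sup>2"
    using e by (simp add: field_simps)
  also have "\<dots> \<le> (\<Sum>k=a..N. \<mu> k * (G k)\<^sup>2)"
    unfolding sum_distrib_right
    using e \<mu> by (intro sum_mono mult_left_mono power_mono big) (auto simp: a_def less_imp_le)
  also have "\<dots> \<le> C"
    using N(1) by (intro bound) (auto simp: a_def)
  finally show False by simp
qed

lemma liminf_eq_0_of_frequently_small:
  fixes G :: "nat \<Rightarrow> real"
  assumes "\<And>k. G k \<ge> 0" "\<And>e K. e > 0 \<Longrightarrow> \<exists>k\<ge>K. G k < e"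
  shows "liminf (\<lambda>k. ereal (G k)) = 0"
proof (rule antisym)
  show "liminf (\<lambda>k. ereal (G k)) \<le> 0"
  proof (rule ccontr)
    assume "\<not> ?thesis"
    then obtain e where e: "0 < ereal e" "ereal e < liminf (\<lambda>k. ereal (G k))"
      using ereal_dense2[of 0 "liminf (\<lambda>k. ereal (G k))"] by (metis not_le)
    have "\<forall>\<^sub>F k in sequentially. ereal e < ereal (G k)"
      using e(2) by (rule less_LiminfD)
    then obtain K where "\<And>k. k \<ge> K \<Longrightarrow> e < G k"
      unfolding eventually_sequentially by auto
    then show False
      using assms(2)[of e K] e(1) by fastforce
  qed
  show "0 \<le> liminf (\<lambda>k. ereal (G k))"
    by (rule Liminf_bounded) (use assms(1) in simp)
qed

text \<open>Dependent choice: the l-th index is taken beyond the previous one with value below 1 /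
  (l + 1), and all indices are at least 1, where the algorithm starts.\<close>

lemma subsequence_tendsto_0_of_frequently_small:
  fixes G :: "nat \<Rightarrow> real"
  assumes nn: "\<And>k. G k \<ge> 0" and small: "\<And>e K. e > 0 \<Longrightarrow> \<exists>k\<ge>K. G k < e"
  shows "\<exists>m :: nat \<Rightarrow> nat. strict_mono m \<and> (\<forall>l. m l \<ge> 1) \<and> (\<lambda>l. G (m l)) \<longlonglongrightarrow> 0"
proof -
  have "\<exists>m. \<forall>l. (m l \<ge> 1 \<and> G (m l) < inverse (real (Suc l))) \<and> m l < m (Suc l)"
  proof (rule dependent_nat_choice)
    show "\<exists>k. k \<ge> 1 \<and> G k < inverse (real (Suc 0))"
      using small[of 1 1] by auto
    show "\<exists>k'. (k' \<ge> 1 \<and> G k' < inverse (real (Suc (Suc l)))) \<and> k < k'" for k l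
      using small[of "inverse (real (Suc (Suc l)))" "Suc k"]
      by (metis Suc_le_eq inverse_positive_iff_positive le_add1 of_nat_0_less_iff order.trans plus_1_eq_Suc zero_less_Suc)
  qed
  then obtain m where m: "\<And>l. m l \<ge> 1" "\<And>l. G (m l) < inverse (real (Suc l))" "\<And>l. m l < m (Suc l)"
    by blast
  have "(\<lambda>l. G (m l)) \<longlonglongrightarrow> 0"
    by (rule tendsto_sandwich[OF _ _ tendsto_const LIMSEQ_inverse_real_of_nat])
      (use nn m(2) in \<open>auto simp: less_imp_le\<close>)
  then show ?thesis
    using m(1,3) by (auto simp: strict_mono_Suc_iff intro!: exI[of _ m])
qed

section \<open>Descent along the algorithm and the final assembly\<close>

lemma variable_smoothing_weighted_sum_bounded:
  fixes f g :: "'b::euclidean_space \<Rightarrow> real" and S :: "'a::euclidean_space \<Rightarrow> 'b" and x :: "nat \<Rightarrow> 'a"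
  assumes f: "Lf-lipschitz_on UNIV f" and g: "Lg-lipschitz_on UNIV g"
    and bdd: "bdd_below (range (dc_objective f g S))"
    and \<omega>: "\<omega>1 > 0" "\<omega>2 > 0" and descent: "descent_assumption f g S \<eta> \<omega>1 \<omega>2"
    and \<mu>: "\<And>k. k \<ge> 1 \<Longrightarrow> \<mu> k \<in> {0<..inverse (2 * \<eta>)}" "\<And>k. k \<ge> 1 \<Longrightarrow> \<mu> k \<ge> \<mu> (Suc k)"
    and \<gamma>init: "\<And>k. k \<ge> 1 \<Longrightarrow> \<gamma>init k > 0"
      "\<And>k. k \<ge> 1 \<Longrightarrow> \<gamma>init k \<ge> \<delta> * inverse (kappa \<omega>1 \<omega>2 (\<mu> k))"
    and \<delta>: "\<delta> > 0" and \<rho>: "\<rho> \<in> {0<..<1}" and c: "c \<in> {0<..<1}"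
    and alg: "variable_smoothing f g S \<mu> \<gamma>init \<rho> c x1 x"
  shows "\<exists>C>0. \<forall>a b. 1 \<le> a \<and> a \<le> b \<longrightarrow>
           (\<Sum>k=a..b. \<mu> k * (norm (grad (surrogate f g S (\<mu> k)) (x k)))\<^sup>2) \<le> C"
proof -
  define G where "G k = norm (grad (surrogate f g S (\<mu> k)) (x k))" for k
  define E where "E k = surrogate f g S (\<mu> k) (x k) + \<mu> k * Lf\<^sup>2 / 2" for k
  \<comment> \<open>Chosen so that \<beta> / \<kappa> is below both alternatives of the backtracking
    bound: the initial step and \<rho> 2 (1 - c) / \<kappa>.\<close>
  define \<beta> where "\<beta> = min \<delta> (2 * \<rho> * (1 - c))"
  define M where "M = inverse (2 * \<eta>)"
  \<comment> \<open>The factor c is from Armijo; the rest is the ratio to \<open>\<mu> k\<close> of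
    the lower bound for the stepsize.\<close>
  define \<tau> where "\<tau> = c * (\<beta> / (\<omega>1 * M + \<omega>2))"
  have M: "M > 0" using \<mu>(1)[of 1] unfolding M_def by (metis greaterThanAtMost_iff less_le_trans order_refl)
  have \<beta>: "\<beta> > 0" using \<delta> \<rho> c by (simp add: \<beta>_def)
  have \<tau>: "\<tau> > 0" using \<beta> c \<omega> M by (simp add: \<tau>_def add_pos_pos)
  obtain l where l: "\<And>y. l \<le> dc_objective f g S y"
    using bdd by (auto simp: bdd_below_def)
  have dec: "E (Suc k) \<le> E k - \<tau> * \<mu> k * (G k)\<^sup>2" if k: "k \<ge> 1" for k
  proof -
    define K where "K = kappa \<omega>1 \<omega>2 (\<mu> k)"
    define h where "h = surrogate f g S (\<mu> k)"
    define \<gamma> where "\<gamma> = backtracking h (x k) (\<gamma>init k) \<rho> c"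
    have \<mu>k: "0 < \<mu> k" "\<mu> k \<le> M" using \<mu>(1)[OF k] by (auto simp: M_def)
    have K: "K > 0" using \<omega> \<mu>k by (simp add: K_def kappa_def add_pos_pos)
    have "armijo h (x k) c \<gamma> \<and> min (\<gamma>init k) (\<rho> * (2 * (1 - c) / K)) \<le> \<gamma>"
      unfolding \<gamma>_def
    proof (rule backtracking_stepsize[OF _ K])
      show "h y \<le> h (x k) + grad h (x k) \<bullet> (y - x k) + K / 2 * (norm (y - x k))\<^sup>2" for y
        using descent \<mu>(1)[OF k] unfolding descent_assumption_def h_def K_def by blast
    qed (use \<gamma>init(1)[OF k] \<rho> c in auto)
    then have arm: "armijo h (x k) c \<gamma>" and low: "min (\<gamma>init k) (\<rho> * (2 * (1 - c) / K)) \<le> \<gamma>"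
      by auto
    have "\<beta> * (\<mu> k / (\<omega>1 * M + \<omega>2)) \<le> \<beta> * inverse K"
      unfolding K_def using \<beta> by (intro mult_left_mono inverse_kappa_ge \<omega> \<mu>k) auto
    also have "\<dots> \<le> min (\<gamma>init k) (\<rho> * (2 * (1 - c) / K))"
    proof (rule min.boundedI)
      have "\<beta> * inverse K \<le> \<delta> * inverse K"
        using K by (intro mult_right_mono) (auto simp: \<beta>_def)
      then show "\<beta> * inverse K \<le> \<gamma>init k"
        using \<gamma>init(2)[OF k] by (simp add: K_def)
      have "\<beta> * inverse K \<le> (2 * \<rho> * (1 - c)) * inverse K"
        using K by (intro mult_right_mono) (auto simp: \<beta>_def)
      then show "\<beta> * inverse K \<le> \<rho> * (2 * (1 - c) / K)"
        by (simp add: field_simps)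
    qed
    finally have "\<beta> * (\<mu> k / (\<omega>1 * M + \<omega>2)) \<le> \<gamma>" using low by linarith
    then have "c * (\<beta> * (\<mu> k / (\<omega>1 * M + \<omega>2))) * (G k)\<^sup>2 \<le> c * \<gamma> * (G k)\<^sup>2"
      using c by (intro mult_right_mono mult_left_mono) auto
    then have step: "\<tau> * \<mu> k * (G k)\<^sup>2 \<le> c * \<gamma> * (G k)\<^sup>2"
      by (simp add: \<tau>_def)
    have x: "x (Suc k) = x k - \<gamma> *\<^sub>R grad h (x k)"
      using alg k by (simp add: variable_smoothing_def \<gamma>_def h_def)
    have "h (x (Suc k)) \<le> h (x k) - c * \<gamma> * (G k)\<^sup>2"
      using arm unfolding armijo_def x by (simp add: G_def h_def)
    \<comment> \<open>One iteration splits in two: the Armijo decrease at the fixed parameter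
      \<open>\<mu> k\<close>, then the change of parameter at the fixed point
      \<open>x (Suc k)\<close>.\<close>
    moreover have "E (Suc k) \<le> h (x (Suc k)) + \<mu> k * Lf\<^sup>2 / 2"
      unfolding E_def h_def
      using \<mu>(1)[of "Suc k"] \<mu>(2)[OF k] by (intro surrogate_shrink_parameter[OF f g]) auto
    ultimately show ?thesis
      using step unfolding E_def h_def by linarith
  qed
  have lower: "l \<le> E k" if "k \<ge> 1" for k
    using surrogate_ge[OF f g, of "\<mu> k" S "x k"] l[of "x k"] \<mu>(1)[OF that] by (simp add: E_def)
  \<comment> \<open>The added 1 makes the constant positive even when
    \<open>E 1 = l\<close>.\<close>
  have "(\<Sum>k=a..b. \<mu> k * (G k)\<^sup>2) \<le> (E 1 - l) / \<tau> + 1" if "1 \<le> a" "a \<le> b" for a b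
    using weighted_sum_le_of_descent[of E \<tau> \<mu> G l, OF dec lower \<tau> _ that] \<mu>(1) by fastforce
  moreover have "(E 1 - l) / \<tau> + 1 > 0"
    using lower[of 1] \<tau> by (simp add: add_nonneg_pos)
  ultimately show ?thesis
    unfolding G_def by blast
qed

theorem mainTheorem1:
  fixes f g :: "real ^ 'n \<Rightarrow> real"
    and S :: "real ^ 'd \<Rightarrow> real ^ 'n"
    and DS :: "real ^ 'd \<Rightarrow> (real ^ 'd) \<Rightarrow>\<^sub>L (real ^ 'n)"
    and \<eta>f \<eta>g \<eta> Lf Lg LDS \<omega>1 \<omega>2 \<delta> \<rho> c :: real
    and \<mu> \<gamma>init :: "nat \<Rightarrow> real"
    and x1 :: "real ^ 'd"
    and x :: "nat \<Rightarrow> real ^ 'd"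
  assumes "\<eta>f > 0" and "weakly_convex \<eta>f f"
    and "\<eta>g > 0" and "weakly_convex \<eta>g g"
    and "Lf > 0" and "Lf-lipschitz_on UNIV f"
    and "Lg > 0" and "Lg-lipschitz_on UNIV g"
    and "\<eta> = max \<eta>f \<eta>g"
    and "\<And>y. (S has_derivative blinfun_apply (DS y)) (at y)"
    and "LDS-lipschitz_on UNIV DS"
    and "bdd_below (range (dc_objective f g S))"
    and "\<omega>1 > 0" and "\<omega>2 > 0" and "descent_assumption f g S \<eta> \<omega>1 \<omega>2"
    and "\<And>k. k \<ge> 1 \<Longrightarrow> \<mu> k \<in> {0<..inverse (2 * \<eta>)}"
    and "\<mu> \<longlonglongrightarrow> 0"
    and "filterlim (\<lambda>N. \<Sum>k=1..N. \<mu> k) at_top sequentially"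
    and "\<And>k. k \<ge> 1 \<Longrightarrow> \<mu> k \<ge> \<mu> (Suc k)"
    and "\<And>k. k \<ge> 1 \<Longrightarrow> \<gamma>init k > 0"
    and "\<delta> > 0" and "\<And>k. k \<ge> 1 \<Longrightarrow> \<gamma>init k \<ge> \<delta> * inverse (kappa \<omega>1 \<omega>2 (\<mu> k))"
    and "\<rho> \<in> {0<..<1}" and "c \<in> {0<..<1}"
    and "variable_smoothing f g S \<mu> \<gamma>init \<rho> c x1 x"
  defines "G \<equiv> \<lambda>k. norm (grad (surrogate f g S (\<mu> k)) (x k))"
  shows "(\<exists>C>0. \<forall>a b. 1 \<le> a \<and> a \<le> b \<longrightarrow> (MIN k\<in>{a..b}. G k) \<le> sqrt (C / (\<Sum>k=a..b. \<mu> k)))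
    \<and> liminf (\<lambda>k. ereal (G k)) = 0
    \<and> (\<exists>m :: nat \<Rightarrow> nat. strict_mono m \<and> (\<forall>l. m l \<ge> 1) \<and> (\<lambda>l. G (m l)) \<longlonglongrightarrow> 0)
    \<and> (\<forall>m :: nat \<Rightarrow> nat. strict_mono m \<and> (\<forall>l. m l \<ge> 1) \<and> (\<lambda>l. G (m l)) \<longlonglongrightarrow> 0 \<longrightarrow>
         (\<forall>p. cluster_point (\<lambda>l. x (m l)) p \<longrightarrow> dc_composite_critical f g S p))"
proof -
  note f = \<open>Lf-lipschitz_on UNIV f\<close> and g = \<open>Lg-lipschitz_on UNIV g\<close>
  have \<mu>: "\<And>k. k \<ge> 1 \<Longrightarrow> \<mu> k \<in> {0<..inverse (2 * \<eta>)}" by fact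
  have \<mu>_pos: "\<mu> k > 0" if "k \<ge> 1" for k using \<mu>[OF that] by simp
  obtain C where C: "C > 0" "\<And>a b. 1 \<le> a \<Longrightarrow> a \<le> b \<Longrightarrow> (\<Sum>k=a..b. \<mu> k * (G k)\<^sup>2) \<le> C"
    unfolding G_def using variable_smoothing_weighted_sum_bounded[OF f g assms(12-16,19,20,22,21,23-25)]
    by blast
  have G0: "G k \<ge> 0" for k by (simp add: G_def)
  have small: "\<exists>k\<ge>K. G k < e" if "e > 0" for e K
    using frequently_small_of_weighted_sum[OF C(2) assms(18) \<mu>_pos that] .
  have rate: "(MIN k\<in>{a..b}. G k) \<le> sqrt (C / (\<Sum>k=a..b. \<mu> k))" if "1 \<le> a \<and> a \<le> b" for a b
    using that by (intro Min_le_sqrt_weighted_mean C(2) G0) (auto intro: \<mu>_pos)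
  have crit: "dc_composite_critical f g S p"
    if m: "strict_mono m" "\<forall>l. m l \<ge> 1" "(\<lambda>l. G (m l)) \<longlonglongrightarrow> 0" and p: "cluster_point (\<lambda>l. x (m l)) p"
    for m :: "nat \<Rightarrow> nat" and p
  proof -
    obtain r where r: "strict_mono (r :: nat \<Rightarrow> nat)" "(\<lambda>l. x (m (r l))) \<longlonglongrightarrow> p"
      using p by (auto simp: cluster_point_def o_def)
    \<comment> \<open>The bound of \<mu> by 1 / (2 \<eta>), with \<eta> the larger modulus, gives
      the factor 1/2 needed for both envelopes.\<close>
    have small_\<mu>: "\<mu> (m (r l)) * \<theta> \<le> 1 / 2" if "0 < \<theta>" "\<theta> \<le> \<eta>" for l \<theta>
    proof -
      have "\<mu> (m (r l)) * \<theta> \<le> inverse (2 * \<eta>) * \<eta>"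
        using \<mu>[of "m (r l)"] m(2) that by (intro mult_mono) auto
      then show ?thesis using that by simp
    qed
    show ?thesis
    proof (rule dc_composite_critical_limit[OF f \<open>weakly_convex \<eta>f f\<close> g \<open>weakly_convex \<eta>g g\<close> assms(10)
          lipschitz_on_continuous_on[OF \<open>LDS-lipschitz_on UNIV DS\<close>] _ _ _ _ r(2)])
      show "\<mu> (m (r l)) > 0" for l using m(2) \<mu>_pos by simp
      show "\<mu> (m (r l)) * \<eta>f \<le> 1 / 2" "\<mu> (m (r l)) * \<eta>g \<le> 1 / 2" for l
        using assms(1,3,9) by (intro small_\<mu>; simp)+
      show "(\<lambda>l. \<mu> (m (r l))) \<longlonglongrightarrow> 0"
        using LIMSEQ_subseq_LIMSEQ[OF LIMSEQ_subseq_LIMSEQ[OF \<open>\<mu> \<longlonglongrightarrow> 0\<close> m(1)] r(1)]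
        by (simp add: o_def)
      show "(\<lambda>l. norm (grad (surrogate f g S (\<mu> (m (r l)))) (x (m (r l))))) \<longlonglongrightarrow> 0"
        using LIMSEQ_subseq_LIMSEQ[OF m(3) r(1)] by (simp add: o_def G_def)
    qed
  qed
  show ?thesis
    using C(1) rate liminf_eq_0_of_frequently_small[OF G0 small]
      subsequence_tendsto_0_of_frequently_small[OF G0 small] crit
    by blast
qed

end
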